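(* Let $D$ be a fat disk-polygon (with some parameter $r>0$) in the Euclidean plane $\mathbb{E}^2$. Then any shortest generalized billiard trajectory of $D$ (i.e. any generalized billiard trajectory of minimal length among all generalized billiard trajectories of $D$, of all periods) is $2$-periodic.
   Context: A disk-polygon with parameter $r>0$ is the intersection of finitely many closed circular disks of radius $r$ in $\mathbb{E}^2$ (called its generating disks) having some interior point in common. It is assumed that all generating disks are needed, i.e. each of them contributes a circular arc to the boundary of the disk-polygon. A fat disk-polygon with parameter $r>0$ is a disk-polygon with parameter $r$ such that the pairwise distances between the centers of its generating disks are at most $r$. A closed polygonal path (possibly with self-intersections) is given by a cyclic sequence of vertices $p_1,\dots,p_n$, $n\ge 2$, whose sides are the segments $p_ip_{i+1}$ (indices mod $n$); consecutive vertices are distinct, and the vertices are genuine, i.e. consecutive sides at a vertex do not form an angle equal to $\pi$. For $n=2$ the path is a doubly covered line segment. The length of the path is the sum of the lengths of its $n$ sides. The inner angle bisector at $p_i$ is the halfline starting at $p_i$ that bisects the angle formed by the two sides $p_ip_{i-1}$ and $p_ip_{i+1}$ (if the two sides point in the same direction, it is that common direction). For a compact convex set $C\subset\mathbb{E}^2$ with non-empty interior, a closed polygonal path $P$ is a generalized billiard trajectory of $C$ if all vertices of $P$ lie on the boundary of $C$ and each of the inner angle bisectors of $P$ between two consecutive sides of $P$ is perpendicular to a supporting line of $C$ passing through the corresponding vertex of $P$. If $P$ has $n$ sides it is called $n$-periodic. *)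

theory Defs
  imports "HOL-Analysis.Analysis"
begin

section \<open>Disk-polygons\<close>

definition contributes_arc :: "(real^2) set \<Rightarrow> real^2 \<Rightarrow> real \<Rightarrow> bool" where
  "contributes_arc D c r \<longleftrightarrow>
     (\<exists>a b. a < b \<and> (\<forall>t\<in>{a..b}. c + r *\<^sub>R vector [cos t, sin t] \<in> frontier D))"

text \<open>All disks have the same radius, so a family of generating disks is given by its set of centers.\<close>

definition generating_centers :: "real \<Rightarrow> (real^2) set \<Rightarrow> (real^2) set \<Rightarrow> bool" where
  "generating_centers r X D \<longleftrightarrow>
     finite X \<and> X \<noteq> {} \<and> D = (\<Inter>c\<in>X. cball c r) \<and> interior D \<noteq> {} \<and>
     (\<forall>c\<in>X. contributes_arc D c r)"

definition fat_disk_polygon :: "real \<Rightarrow> (real^2) set \<Rightarrow> bool" where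
  "fat_disk_polygon r D \<longleftrightarrow>
     r > 0 \<and> (\<exists>X. generating_centers r X D \<and> (\<forall>c\<in>X. \<forall>c'\<in>X. dist c c' \<le> r))"


section \<open>Closed polygonal paths\<close>

text \<open>\<open>angle_at a p b\<close> is the unoriented angle in \<open>[0, pi]\<close> at \<open>p\<close>; it is only used for
  \<open>a \<noteq> p\<close> and \<open>b \<noteq> p\<close>.\<close>

definition angle_at :: "real^2 \<Rightarrow> real^2 \<Rightarrow> real^2 \<Rightarrow> real" where
  "angle_at a p b = arccos (((a - p) \<bullet> (b - p)) / (norm (a - p) * norm (b - p)))"

text \<open>A path is the list of its vertices, indexed from \<open>0\<close> and read cyclically.\<close>

definition next_vertex :: "(real^2) list \<Rightarrow> nat \<Rightarrow> real^2" where
  "next_vertex P i = P ! ((i + 1) mod length P)"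

definition prev_vertex :: "(real^2) list \<Rightarrow> nat \<Rightarrow> real^2" where
  "prev_vertex P i = P ! ((i + length P - 1) mod length P)"

definition closed_polygonal_path :: "(real^2) list \<Rightarrow> bool" where
  "closed_polygonal_path P \<longleftrightarrow>
     length P \<ge> 2 \<and>
     (\<forall>i<length P. P ! i \<noteq> next_vertex P i) \<and>
     (\<forall>i<length P. angle_at (prev_vertex P i) (P ! i) (next_vertex P i) \<noteq> pi)"

definition path_len :: "(real^2) list \<Rightarrow> real" where
  "path_len P = (\<Sum>i<length P. dist (P ! i) (next_vertex P i))"

definition n_periodic :: "nat \<Rightarrow> (real^2) list \<Rightarrow> bool" where
  "n_periodic n P \<longleftrightarrow> length P = n"

text \<open>For \<open>a \<noteq> p \<noteq> b\<close> and an angle different from \<open>pi\<close>, the points \<open>x \<noteq> p\<close> of the plane that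
  make half the angle with each of the two sides form exactly one open halfline; this includes
  angle \<open>0\<close>, where it is the common direction.\<close>

definition inner_angle_bisector :: "real^2 \<Rightarrow> real^2 \<Rightarrow> real^2 \<Rightarrow> (real^2) set" where
  "inner_angle_bisector a p b =
     insert p {x. x \<noteq> p \<and> angle_at a p x = angle_at a p b / 2 \<and>
                  angle_at x p b = angle_at a p b / 2}"


section \<open>Generalized billiard trajectories\<close>

definition supporting_line :: "(real^2) set \<Rightarrow> (real^2) set \<Rightarrow> bool" where
  "supporting_line C L \<longleftrightarrow>
     (\<exists>a b. a \<noteq> 0 \<and> L = {x. a \<bullet> x = b} \<and> (\<forall>x\<in>C. a \<bullet> x \<le> b) \<and> L \<inter> C \<noteq> {})"

definition perpendicular :: "(real^2) set \<Rightarrow> (real^2) set \<Rightarrow> bool" where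
  "perpendicular H L \<longleftrightarrow>
     (\<forall>x\<in>H. \<forall>y\<in>H. \<forall>u\<in>L. \<forall>v\<in>L. orthogonal (x - y) (u - v))"

definition generalized_billiard_trajectory :: "(real^2) set \<Rightarrow> (real^2) list \<Rightarrow> bool" where
  "generalized_billiard_trajectory C P \<longleftrightarrow>
     closed_polygonal_path P \<and> set P \<subseteq> frontier C \<and>
     (\<forall>i<length P. \<exists>L. supporting_line C L \<and> P ! i \<in> L \<and>
        perpendicular (inner_angle_bisector (prev_vertex P i) (P ! i) (next_vertex P i)) L)"

definition shortest_generalized_billiard_trajectory ::
    "(real^2) set \<Rightarrow> (real^2) list \<Rightarrow> bool" where
  "shortest_generalized_billiard_trajectory C P \<longleftrightarrow>
     generalized_billiard_trajectory C P \<and>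
     (\<forall>Q. generalized_billiard_trajectory C Q \<longrightarrow> path_len P \<le> path_len Q)"

end

theory Submission
  imports Defs
begin

text \<open>
  Let \<open>D\<close> be the intersection of the disks of radius \<open>r\<close> about the points of \<open>X\<close>, and let \<open>d \<le> r\<close> be the
  diameter of \<open>X\<close>. The proof shows that \<open>D\<close> has a 2-periodic trajectory of length \<open>2 (2 r - d)\<close>, and
  that every trajectory with another number of vertices is strictly longer.

  The short trajectory comes from two centers \<open>x\<close>, \<open>y\<close> at distance \<open>d\<close>: the lens of the two disks about
  them has width \<open>2 r - d\<close> in the direction of \<open>x y\<close>, and since \<open>d \<le> r\<close> the chord of the lens in this
  direction lies in all the other disks too, so it is a double normal of \<open>D\<close>
  (\<open>two_periodic_trajectory_of_diameter\<close>).

  For the lower bound, let \<open>p\<^sub>i\<close> be the vertices of a trajectory. The reflection condition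
  yields unit outer normals \<open>u\<^sub>i\<close> of \<open>D\<close> at the \<open>p\<^sub>i\<close> with \<open>0\<close> in their convex hull
  (\<open>trajectory_normals\<close>). As the boundary of \<open>D\<close> consists of arcs of
  radius \<open>r\<close>, a supporting line may be replaced by a supporting disk: \<open>D\<close> lies in the disk of radius
  \<open>r\<close> about \<open>q\<^sub>i = p\<^sub>i - r u\<^sub>i\<close> (\<open>cball_supports_disk_intersection\<close>). Fatness implies that also the new
  centers \<open>q\<^sub>i\<close> have pairwise distances at most \<open>d\<close> (\<open>dist_supporting_centers_le\<close>). By Caratheodory's
  theorem two or three of the \<open>u\<^sub>i\<close> have \<open>0\<close> in their convex hull.

  Two opposite normals give two vertices at distance at least \<open>2 r - d\<close>. With three normals it suffices
  to bound the perimeter of the triangle \<open>p\<^sub>1 p\<^sub>2 p\<^sub>3\<close>. If \<open>d\<^sub>i\<close> are vectors of norm at most \<open>1\<close>, then the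
  perimeter is at least \<open>\<Sum> d\<^sub>i \<bullet> (p\<^sub>i\<^sub>+\<^sub>1 - p\<^sub>i) = \<Sum> (d\<^sub>i\<^sub>-\<^sub>1 - d\<^sub>i) \<bullet> p\<^sub>i\<close>, and one chooses the \<open>d\<^sub>i\<close> so that
  \<open>d\<^sub>i\<^sub>-\<^sub>1 - d\<^sub>i\<close> is a nonnegative multiple of \<open>u\<^sub>i\<close>. Consider the triangle with outer normals \<open>u\<^sub>i\<close>. If it is
  acute, the right \<open>d\<^sub>i\<close> are the side directions of the triangle of its altitude feet, which is the
  shortest inscribed triangle; the bound becomes the inequality \<open>s > 2 R + \<rho>\<close> between
  semiperimeter, circumradius and inradius of acute triangles. Otherwise the \<open>d\<^sub>i\<close> come from
  the doubly covered altitude (\<open>perimeter_if_acute\<close>, \<open>perimeter_if_not_acute\<close>).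

  With two opposite normals, and in the case of equality for three normals, where two of the \<open>p\<^sub>i\<close>
  coincide, the bound for the length is at most twice the distance of two vertices. Strictness then holds
  because a path with at least three genuine vertices is longer than the doubly covered segment between
  two of them (\<open>two_dist_less_path_len\<close>).
\<close>

section \<open>Length of closed polygonal paths\<close>

definition cyclic_vertex :: "(real^2) list \<Rightarrow> nat \<Rightarrow> real^2" where
  "cyclic_vertex P t = P ! (t mod length P)"

lemma sum_periodic_shift:
  fixes f :: "nat \<Rightarrow> real"
  assumes "\<And>t. f (t + n) = f t"
  shows "(\<Sum>t=m..<m+n. f t) = (\<Sum>t<n. f t)"
proof (induction m)
  case 0
  then show ?case by (simp add: lessThan_atLeast0)
next
  case (Suc m)
  have "(\<Sum>t=m..<Suc m + n. f t) = f m + (\<Sum>t=Suc m..<Suc m + n. f t)"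
    by (rule sum.atLeast_Suc_lessThan) simp
  moreover have "(\<Sum>t=m..<Suc m + n. f t) = (\<Sum>t=m..<m + n. f t) + f (m + n)"
    by simp
  ultimately show ?case using Suc assms[of m] by simp
qed

text \<open>The starting vertex of the path may be chosen freely, which lets the proofs below cut the path
  at any vertex.\<close>

lemma path_len_from:
  assumes "P \<noteq> []"
  shows "path_len P =
    (\<Sum>t=m..<m + length P. dist (cyclic_vertex P t) (cyclic_vertex P (Suc t)))"
proof -
  have per: "cyclic_vertex P (t + length P) = cyclic_vertex P t" for t
    by (simp add: cyclic_vertex_def)
  have "path_len P = (\<Sum>t<length P. dist (cyclic_vertex P t) (cyclic_vertex P (Suc t)))"
    unfolding path_len_def next_vertex_def cyclic_vertex_def by (intro sum.cong) auto
  also have "\<dots> = (\<Sum>t=m..<m + length P. dist (cyclic_vertex P t) (cyclic_vertex P (Suc t)))"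
    using per per[of "Suc _"] by (intro sum_periodic_shift[symmetric]) simp
  finally show ?thesis .
qed

lemma dist_le_sum_steps:
  fixes g :: "nat \<Rightarrow> 'a::metric_space"
  assumes "a \<le> b"
  shows "dist (g a) (g b) \<le> (\<Sum>t=a..<b. dist (g t) (g (Suc t)))"
  using assms
proof (induction b rule: dec_induct)
  case base
  then show ?case by simp
next
  case (step b)
  have "dist (g a) (g (Suc b)) \<le> dist (g a) (g b) + dist (g b) (g (Suc b))"
    by (rule dist_triangle)
  with step show ?case by simp
qed

lemma triangle_perimeter_le_path_len:
  assumes "i < length P" "j < length P" "k < length P"
  shows "dist (P ! i) (P ! j) + dist (P ! j) (P ! k) + dist (P ! k) (P ! i) \<le> path_len P"
proof -
  let ?g = "cyclic_vertex P" and ?n = "length P"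
  let ?f = "\<lambda>t. dist (?g t) (?g (Suc t))"
  have ordered: "dist (P ! a) (P ! b) + dist (P ! b) (P ! c) + dist (P ! c) (P ! a) \<le> path_len P"
    if "a \<le> b" "b \<le> c" "c < ?n" for a b c
  proof -
    have g: "?g a = P ! a" "?g b = P ! b" "?g c = P ! c" "?g (a + ?n) = P ! a"
      using that by (auto simp: cyclic_vertex_def)
    have "path_len P = sum ?f {a..<a + ?n}"
      using that by (intro path_len_from) auto
    also have "\<dots> = sum ?f {a..<b} + sum ?f {b..<c} + sum ?f {c..<a + ?n}"
      using that by (simp add: sum.atLeastLessThan_concat)
    finally show ?thesis
      using dist_le_sum_steps[of a b ?g] dist_le_sum_steps[of b c ?g]
        dist_le_sum_steps[of c "a + ?n" ?g] that g by simp
  qed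
  consider "i \<le> j" "j \<le> k" | "i \<le> k" "k \<le> j" | "j \<le> i" "i \<le> k" | "j \<le> k" "k \<le> i"
    | "k \<le> i" "i \<le> j" | "k \<le> j" "j \<le> i" by linarith
  then show ?thesis
    using ordered assms by cases (fastforce simp: dist_commute)+
qed

lemma dist_less_if_angle_not_pi:
  assumes "angle_at a p b \<noteq> pi" "a \<noteq> p" "b \<noteq> p"
  shows "dist a b < dist a p + dist p b"
proof (rule ccontr)
  assume "\<not> ?thesis"
  then have "dist a b = dist a p + dist p b"
    using dist_triangle[of a b p] by linarith
  then have "norm ((a - p) + (p - b)) = norm (a - p) + norm (p - b)"
    by (simp add: dist_norm)
  then have "(a - p) \<bullet> (p - b) = norm (a - p) * norm (p - b)"
    by (simp only: norm_triangle_eq norm_cauchy_schwarz_eq)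
  moreover have "(a - p) \<bullet> (b - p) = - ((a - p) \<bullet> (p - b))"
    by (simp add: inner_diff_right)
  ultimately have "((a - p) \<bullet> (b - p)) / (norm (a - p) * norm (b - p)) = -1"
    using assms by (simp add: norm_minus_commute)
  then show False using assms unfolding angle_at_def by simp
qed

text \<open>The path runs from \<open>P ! i\<close> to \<open>P ! j\<close> and back, which costs at least twice the distance. A third vertex
  \<open>P ! m\<close> makes this strict: its angle is not \<open>pi\<close>, so the path can be shortened by skipping it.\<close>

lemma two_dist_less_path_len:
  assumes P: "closed_polygonal_path P" and n: "length P \<noteq> 2"
    and ij: "i < length P" "j < length P" "i \<noteq> j"
  shows "2 * dist (P ! i) (P ! j) < path_len P"
proof -
  let ?g = "cyclic_vertex P" and ?n = "length P"
  let ?f = "\<lambda>t. dist (?g t) (?g (Suc t))"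
  have n3: "?n \<ge> 3" using P n by (auto simp: closed_polygonal_path_def)
  obtain m where m: "m < ?n" "m \<noteq> i" "m \<noteq> j"
  proof -
    have "card {i, j} < card {..<?n}" using n3 ij by simp
    then have "\<not> {..<?n} \<subseteq> {i, j}" by (meson card_mono finite.emptyI finite_insert not_le)
    then show ?thesis using that by blast
  qed
  have pos: "\<exists>a. 1 \<le> a \<and> a \<le> ?n - 1 \<and> ?g (m + a) = P ! x" if "x < ?n" "x \<noteq> m" for x
  proof (cases "m < x")
    case True
    then show ?thesis using that by (intro exI[of _ "x - m"]) (auto simp: cyclic_vertex_def)
  next
    case False
    have "m + (x + ?n - m) = x + ?n" using m by simp
    then show ?thesis using False that m
      by (intro exI[of _ "x + ?n - m"]) (auto simp: cyclic_vertex_def)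
  qed
  \<comment> \<open>Positions are counted from \<open>m\<close>, so that the shortcut past \<open>P ! m\<close> joins the positions \<open>n - 1\<close>
    and \<open>1\<close>, and the two given vertices lie in between.\<close>
  have ordered: "2 * dist (?g (m + a)) (?g (m + b)) < path_len P"
    if "1 \<le> a" "a \<le> b" "b \<le> ?n - 1" for a b
  proof -
    have nv: "next_vertex P m = ?g (m + 1)" "P ! m = ?g m" "P ! m = ?g (m + ?n)"
      "prev_vertex P m = ?g (m + (?n - 1))"
      using m n3 by (auto simp: next_vertex_def prev_vertex_def cyclic_vertex_def)
    have ne: "P ! m \<noteq> next_vertex P m" using P m by (auto simp: closed_polygonal_path_def)
    have ne': "prev_vertex P m \<noteq> P ! m"
    proof -
      let ?k = "(m + ?n - 1) mod ?n"
      have "?k < ?n" using n3 by (intro mod_less_divisor) linarith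
      then have ne_k: "P ! ?k \<noteq> next_vertex P ?k" using P by (auto simp: closed_polygonal_path_def)
      have "(?k + 1) mod ?n = (m + ?n - 1 + 1) mod ?n" by (rule mod_add_left_eq)
      moreover have "m + ?n - 1 + 1 = m + ?n" using n3 by simp
      ultimately have "(?k + 1) mod ?n = m" using m by (simp only: mod_add_self2 mod_less)
      with ne_k show ?thesis by (simp add: next_vertex_def prev_vertex_def)
    qed
    have ang: "angle_at (prev_vertex P m) (P ! m) (next_vertex P m) \<noteq> pi"
      using P m by (auto simp: closed_polygonal_path_def)
    have "dist (?g (m + (?n - 1))) (?g (m + 1)) < dist (?g (m + (?n - 1))) (?g (m + ?n)) + dist (?g m) (?g (m + 1))"
      using dist_less_if_angle_not_pi[OF ang ne' ne[symmetric]] nv by simp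
    moreover have "path_len P = sum ?f {m..<m + ?n}"
      using m by (intro path_len_from) auto
    moreover have "sum ?f {m..<m + ?n} = ?f m + sum ?f {m+1..<m+a} + sum ?f {m+a..<m+b}
        + sum ?f {m+b..<m + (?n - 1)} + ?f (m + (?n - 1))"
    proof -
      have "sum ?f {m..<m + ?n} = sum ?f {m..<m+1} + sum ?f {m+1..<m+a} + sum ?f {m+a..<m+b}
        + sum ?f {m+b..<m + (?n - 1)} + sum ?f {m + (?n - 1)..<m + ?n}"
        using that n3 by (simp only: sum.atLeastLessThan_concat add_left_mono diff_le_self order_trans)
      moreover have "{m + (?n - 1)..<m + ?n} = {m + (?n - 1)}" using n3 by auto
      ultimately show ?thesis by simp
    qed
    moreover have "Suc (m + (?n - 1)) = m + ?n" using n3 by simp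
    then have "?f (m + (?n - 1)) = dist (?g (m + (?n - 1))) (?g (m + ?n))" by (simp only:)
    moreover have "?f m = dist (?g m) (?g (m + 1))" by simp
    moreover have "dist (?g (m+1)) (?g (m+a)) \<le> sum ?f {m+1..<m+a}"
      "dist (?g (m+a)) (?g (m+b)) \<le> sum ?f {m+a..<m+b}"
      "dist (?g (m+b)) (?g (m+(?n-1))) \<le> sum ?f {m+b..<m+(?n-1)}"
      using that by (auto intro!: dist_le_sum_steps)
    moreover have "dist (?g (m+a)) (?g (m+b)) \<le> dist (?g (m+1)) (?g (m+a))
       + dist (?g (m+b)) (?g (m+(?n-1))) + dist (?g (m + (?n - 1))) (?g (m + 1))"
      using dist_triangle[of "?g (m+a)" "?g (m+b)" "?g (m+1)"]
        dist_triangle[of "?g (m+1)" "?g (m+b)" "?g (m+(?n-1))"]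
      by (simp add: dist_commute)
    ultimately show ?thesis by linarith
  qed
  obtain a where a: "1 \<le> a" "a \<le> ?n - 1" "?g (m + a) = P ! i" using pos ij m by metis
  obtain b where b: "1 \<le> b" "b \<le> ?n - 1" "?g (m + b) = P ! j" using pos ij m by metis
  show ?thesis
  proof (cases "a \<le> b")
    case True
    then show ?thesis using ordered[of a b] a b by simp
  next
    case False
    then show ?thesis using ordered[of b a] a b by (simp add: dist_commute)
  qed
qed

section \<open>Disk intersections and their supporting disks\<close>

text \<open>If \<open>x\<close> were a point of the intersection outside the supporting disk, then \<open>p\<close> could be moved a little
  inside the intersection towards the positive side of the supporting line: a short arc of radius \<open>r\<close>
  from \<open>p\<close> to \<open>x\<close> stays in every disk of radius \<open>r\<close> that contains both points. Instead of the arc the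
  proof uses the direction \<open>v\<close>, which has a negative product with the outer normals of all disks
  having \<open>p\<close> on their boundary, but a positive one with \<open>u\<close>.\<close>

lemma cball_supports_disk_intersection:
  fixes p u :: "'a::real_inner"
  assumes X: "finite X" and r: "r > 0" and p: "p \<in> (\<Inter>c\<in>X. cball c r)"
    and u: "norm u = 1" and sup: "\<And>x. x \<in> (\<Inter>c\<in>X. cball c r) \<Longrightarrow> u \<bullet> x \<le> u \<bullet> p"
  shows "(\<Inter>c\<in>X. cball c r) \<subseteq> cball (p - r *\<^sub>R u) r"
proof (rule ccontr)
  assume "\<not> ?thesis"
  then obtain x where x: "x \<in> (\<Inter>c\<in>X. cball c r)" "x \<notin> cball (p - r *\<^sub>R u) r"
    by blast
  define y where "y = x - p"
  define s where "s = (y \<bullet> y) / (2 * r)"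
  have "norm (y + r *\<^sub>R u) > r"
    using x(2) by (simp add: y_def dist_norm norm_minus_commute diff_diff_eq2 diff_add_eq)
  then have "(norm (y + r *\<^sub>R u))\<^sup>2 > r\<^sup>2" using r by (simp add: power_strict_mono)
  moreover have uu: "u \<bullet> u = 1" using u by (simp add: dot_square_norm)
  moreover have "(norm (y + r *\<^sub>R u))\<^sup>2 = y \<bullet> y + 2 * r * (y \<bullet> u) + r\<^sup>2 * (u \<bullet> u)"
    unfolding power2_norm_eq_inner by (simp add: algebra_simps inner_commute power2_eq_square)
  ultimately have "y \<bullet> y + 2 * r * (y \<bullet> u) > 0" by simp
  then have yu: "y \<bullet> u > - s" using r by (simp add: s_def field_simps)
  define v where "v = y + s *\<^sub>R u"
  have vu: "u \<bullet> v > 0" using yu uu by (simp add: v_def inner_add_right inner_commute)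
  have s0: "s > 0"
  proof -
    have "y \<noteq> 0" using \<open>norm (y + r *\<^sub>R u) > r\<close> u r by auto
    then show ?thesis using r by (simp add: s_def)
  qed
  have ev: "\<forall>\<^sub>F t in at_right 0. p + t *\<^sub>R v \<in> cball c r" if c: "c \<in> X" for c
  proof (cases "dist c p < r")
    case True
    have "((\<lambda>t. dist c (p + t *\<^sub>R v)) \<longlongrightarrow> dist c (p + 0 *\<^sub>R v)) (at_right 0)"
      by (intro tendsto_intros)
    then have "\<forall>\<^sub>F t in at_right 0. dist c (p + t *\<^sub>R v) < r"
      using True by (intro order_tendstoD) auto
    then show ?thesis by eventually_elim auto
  next
    case False
    then have pc: "norm (p - c) = r" using p c by (auto simp: dist_norm norm_minus_commute)
    then have pc2: "(p - c) \<bullet> (p - c) = r\<^sup>2" by (simp add: dot_square_norm)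
    have "norm (x - c) \<le> r" using x c by (auto simp: dist_norm norm_minus_commute)
    then have "(norm (y + (p - c)))\<^sup>2 \<le> r\<^sup>2"
      by (simp add: y_def power_mono)
    then have "y \<bullet> y + 2 * (y \<bullet> (p - c)) \<le> 0"
      unfolding power2_norm_eq_inner using pc2
      by (simp add: inner_add_left inner_add_right inner_commute)
    then have yc: "y \<bullet> (p - c) \<le> - r * s" using r by (simp add: s_def)
    have le: "u \<bullet> (p - c) \<le> r" using norm_cauchy_schwarz[of u "p - c"] u pc by simp
    \<comment> \<open>A generating disk with outer normal \<open>u\<close> at \<open>p\<close> is the supporting disk itself and contains \<open>x\<close>.\<close>
    have "u \<bullet> (p - c) \<noteq> r"
    proof
      assume "u \<bullet> (p - c) = r"
      then have "u \<bullet> (p - c) = norm u * norm (p - c)" using u pc by simp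
      then have "p - c = r *\<^sub>R u" using norm_cauchy_schwarz_eq[of u "p - c"] u pc by simp
      then have "r * (y \<bullet> u) \<le> - r * s" using yc by simp
      then show False using mult_strict_left_mono[OF yu r] by simp
    qed
    then have "s * (u \<bullet> (p - c)) < s * r" using le s0 by simp
    then have neg: "v \<bullet> (p - c) < 0"
      using yc by (simp add: v_def inner_add_left mult.commute)
    have "((\<lambda>t. t * (v \<bullet> v) + 2 * (v \<bullet> (p - c))) \<longlongrightarrow> 0 * (v \<bullet> v) + 2 * (v \<bullet> (p - c))) (at_right 0)"
      by (intro tendsto_intros)
    then have "\<forall>\<^sub>F t in at_right 0. t * (v \<bullet> v) + 2 * (v \<bullet> (p - c)) < 0"
      by (rule order_tendstoD(2)) (simp add: neg)
    moreover have "\<forall>\<^sub>F t :: real in at_right 0. t > 0" by (rule eventually_at_right_less)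
    ultimately show ?thesis
    proof eventually_elim
      case (elim t)
      have "(norm (p + t *\<^sub>R v - c))\<^sup>2 = r\<^sup>2 + t * (t * (v \<bullet> v) + 2 * (v \<bullet> (p - c)))"
      proof -
        have "(norm (p + t *\<^sub>R v - c))\<^sup>2 = (norm ((p - c) + t *\<^sub>R v))\<^sup>2"
          by (simp add: algebra_simps)
        also have "\<dots> = (p - c) \<bullet> (p - c) + t * (t * (v \<bullet> v) + 2 * (v \<bullet> (p - c)))"
          unfolding power2_norm_eq_inner
          by (simp add: inner_add_left inner_add_right inner_commute distrib_left)
        finally show ?thesis using pc2 by simp
      qed
      also have "\<dots> \<le> r\<^sup>2" using elim by (simp add: mult_le_0_iff)
      finally have "norm (p + t *\<^sub>R v - c) \<le> r" using r by (simp add: abs_le_square_iff[symmetric])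
      then show ?case by (simp add: dist_norm norm_minus_commute)
    qed
  qed
  have "\<forall>\<^sub>F t in at_right 0. \<forall>c\<in>X. p + t *\<^sub>R v \<in> cball c r"
    using X ev by (intro eventually_ball_finite) auto
  moreover have "\<forall>\<^sub>F t :: real in at_right 0. t > 0" by (rule eventually_at_right_less)
  ultimately have "\<forall>\<^sub>F t :: real in at_right 0. False"
  proof eventually_elim
    case (elim t)
    then have "u \<bullet> (p + t *\<^sub>R v) \<le> u \<bullet> p" by (intro sup) auto
    then show False using elim vu by (simp add: inner_add_right mult_le_0_iff)
  qed
  then show False by simp
qed

lemma dist_le_if_cball_subset_cball:
  fixes q z :: "'a::euclidean_space"
  assumes "cball z s \<subseteq> cball q r" "s \<ge> 0"
  shows "dist q z \<le> r - s"
  using assms by (auto simp: cball_subset_cball_iff dist_commute)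

text \<open>A point \<open>z\<close> at distance at most \<open>d\<close> from all centers has the whole disk of radius \<open>r - d\<close> about it
  inside the intersection, hence inside \<open>cball q r\<close>, so \<open>dist q z \<le> d\<close>. The bound is obtained first
  for \<open>z \<in> X\<close> and \<open>q'\<close>; this makes \<open>q'\<close> itself such a point \<open>z\<close>.\<close>

lemma dist_supporting_centers_le:
  fixes X :: "'a::euclidean_space set"
  assumes diam: "\<And>c c'. c \<in> X \<Longrightarrow> c' \<in> X \<Longrightarrow> dist c c' \<le> d" and d: "d \<le> r"
    and q: "(\<Inter>c\<in>X. cball c r) \<subseteq> cball q r" and q': "(\<Inter>c\<in>X. cball c r) \<subseteq> cball q' r"
  shows "dist q q' \<le> d"
proof -
  have fill: "cball z (r - d) \<subseteq> (\<Inter>c\<in>X. cball c r)" if "\<And>c. c \<in> X \<Longrightarrow> dist c z \<le> d" for z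
  proof
    fix x assume x: "x \<in> cball z (r - d)"
    have "dist c x \<le> r" if "c \<in> X" for c
      using dist_triangle[of c x z] x \<open>\<And>c. c \<in> X \<Longrightarrow> dist c z \<le> d\<close>[OF that] by simp
    then show "x \<in> (\<Inter>c\<in>X. cball c r)" by simp
  qed
  \<comment> \<open>A center \<open>c\<close> is such a point by the diameter bound.\<close>
  have "dist q' c \<le> d" if "c \<in> X" for c
    using dist_le_if_cball_subset_cball[of c "r - d" q' r] fill[of c] diam that q' d by fastforce
  then have "cball q' (r - d) \<subseteq> cball q r"
    using fill[of q'] q by (fastforce simp: dist_commute)
  then show ?thesis using dist_le_if_cball_subset_cball[of q' "r - d" q r] d by simp
qed

section \<open>Two-periodic trajectories\<close>

lemma angle_at_same:
  assumes "a \<noteq> p" shows "angle_at a p a = 0"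
  using assms by (simp add: angle_at_def dot_square_norm power2_eq_square)

lemma parallel_if_angle_at_eq_0:
  assumes "angle_at a p x = 0" "a \<noteq> p" "x \<noteq> p"
  shows "\<exists>k. x - p = k *\<^sub>R (a - p)"
proof -
  define t where "t = ((a - p) \<bullet> (x - p)) / (norm (a - p) * norm (x - p))"
  have "\<bar>t\<bar> \<le> 1"
    using Cauchy_Schwarz_ineq2[of "a - p" "x - p"] assms by (simp add: t_def abs_mult divide_le_eq)
  then have "cos (arccos t) = t" by (rule cos_arccos_abs)
  then have "t = 1" using assms(1) unfolding angle_at_def t_def[symmetric] by simp
  then have "(a - p) \<bullet> (x - p) = norm (a - p) * norm (x - p)" using assms by (simp add: t_def)
  then have "norm (a - p) *\<^sub>R (x - p) = norm (x - p) *\<^sub>R (a - p)" by (simp only: norm_cauchy_schwarz_eq)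
  then have "x - p = (norm (x - p) / norm (a - p)) *\<^sub>R (a - p)"
    using assms by (metis (no_types, lifting) divideR_right divide_inverse_commute norm_eq_zero right_minus_eq scaleR_scaleR)
  then show ?thesis by blast
qed

text \<open>For two coinciding sides the bisector is contained in the line of the sides, as a zero angle forces parallel
  vectors.\<close>

lemma perpendicular_degenerate_bisector:
  assumes "b \<noteq> a"
  shows "perpendicular (inner_angle_bisector b a b) {x. (a - b) \<bullet> x = (a - b) \<bullet> a}"
proof -
  have ray: "\<exists>k. x - a = k *\<^sub>R (b - a)" if "x \<in> inner_angle_bisector b a b" for x
    using that assms parallel_if_angle_at_eq_0[of b a x] angle_at_same[of b a]
    by (auto simp: inner_angle_bisector_def intro: exI[of _ 0])
  have par: "\<exists>k. x - y = k *\<^sub>R (a - b)"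
    if xy: "x \<in> inner_angle_bisector b a b" "y \<in> inner_angle_bisector b a b" for x y
  proof -
    obtain k l where "x - a = k *\<^sub>R (b - a)" "y - a = l *\<^sub>R (b - a)"
      using ray[of x] ray[of y] xy by blast
    then have "(x - a) - (y - a) = (l - k) *\<^sub>R (a - b)"
      by (simp only:) (simp add: algebra_simps)
    then have "x - y = (l - k) *\<^sub>R (a - b)" by simp
    then show ?thesis by blast
  qed
  have "(x - y) \<bullet> (v - w) = 0"
    if xy: "x \<in> inner_angle_bisector b a b" "y \<in> inner_angle_bisector b a b"
      and vw: "(a - b) \<bullet> v = (a - b) \<bullet> a" "(a - b) \<bullet> w = (a - b) \<bullet> a" for x y v w
  proof -
    obtain k where "x - y = k *\<^sub>R (a - b)" using par xy by blast
    moreover have "(a - b) \<bullet> (v - w) = 0" using vw by (simp only: inner_diff_right[of "a - b"])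
    ultimately show ?thesis by (simp only: inner_scaleR_left mult_zero_right)
  qed
  then show ?thesis unfolding perpendicular_def orthogonal_def by blast
qed

lemma double_normal_trajectory:
  assumes ab: "a \<in> frontier C" "b \<in> frontier C" "a \<noteq> b" and cl: "closed C"
    and strip: "\<And>x. x \<in> C \<Longrightarrow> (a - b) \<bullet> b \<le> (a - b) \<bullet> x \<and> (a - b) \<bullet> x \<le> (a - b) \<bullet> a"
  shows "generalized_billiard_trajectory C [a, b]"
proof -
  have nv: "next_vertex [a, b] 0 = b" "next_vertex [a, b] (Suc 0) = a"
    "prev_vertex [a, b] 0 = b" "prev_vertex [a, b] (Suc 0) = a"
    by (simp_all add: next_vertex_def prev_vertex_def)
  have inC: "a \<in> C" "b \<in> C" using ab cl by (auto dest: frontier_subset_closed)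
  have all2: "(\<forall>i<length [a, b]. Q i) \<longleftrightarrow> Q 0 \<and> Q (Suc 0)" for Q
    by (auto simp: less_Suc_eq)
  have "closed_polygonal_path [a, b]"
    unfolding closed_polygonal_path_def all2 using ab by (simp add: nv angle_at_same)
  moreover have "supporting_line C {x. (a - b) \<bullet> x = (a - b) \<bullet> a}"
    unfolding supporting_line_def using ab inC strip
    by (intro exI[of _ "a - b"] exI[of _ "(a - b) \<bullet> a"]) auto
  moreover have "supporting_line C {x. (b - a) \<bullet> x = (b - a) \<bullet> b}"
  proof -
    have "(b - a) \<bullet> x \<le> (b - a) \<bullet> b" if "x \<in> C" for x
      using strip[OF that] by (simp add: inner_diff_left)
    then show ?thesis unfolding supporting_line_def using ab inC
      by (intro exI[of _ "b - a"] exI[of _ "(b - a) \<bullet> b"]) auto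
  qed
  ultimately show ?thesis
    unfolding generalized_billiard_trajectory_def all2
    using ab perpendicular_degenerate_bisector[of b a] perpendicular_degenerate_bisector[of a b]
    by (auto simp: nv)
qed

lemma path_len_two: "path_len [a, b] = 2 * dist a b"
  by (simp add: path_len_def next_vertex_def dist_commute lessThan_Suc)

text \<open>The endpoints \<open>a\<close> and \<open>b\<close> are the farthest points of the disks about \<open>x\<close> and \<open>y\<close> in the direction
  of the other center. Passing through \<open>y\<close> gives \<open>dist c a \<le> d + (r - d) = r\<close> for every center \<open>c\<close>, so they
  belong to the intersection. The direction \<open>e\<close> is arbitrary when there is only one center.\<close>

lemma two_periodic_trajectory_of_diameter:
  fixes X :: "(real^2) set"
  assumes D: "D = (\<Inter>c\<in>X. cball c r)" and r: "r > 0"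
    and xy: "x \<in> X" "y \<in> X" and diam: "\<And>c c'. c \<in> X \<Longrightarrow> c' \<in> X \<Longrightarrow> dist c c' \<le> dist x y"
    and fat: "dist x y \<le> r"
  shows "\<exists>Q. generalized_billiard_trajectory D Q \<and> path_len Q = 2 * (2 * r - dist x y)"
proof -
  define d where "d = dist x y"
  obtain e :: "real^2" where e: "norm e = 1" "y - x = d *\<^sub>R e"
  proof (cases "x = y")
    case True
    obtain e :: "real^2" where "norm e = 1" using vector_choose_size[of 1] by auto
    then show ?thesis using that True by (simp add: d_def)
  next
    case False
    then show ?thesis using that[of "sgn (y - x)"]
      by (simp add: norm_sgn sgn_div_norm d_def dist_norm norm_minus_commute)
  qed
  have d: "0 \<le> d" "d \<le> r" using fat by (auto simp: d_def)
  define a where "a = x + r *\<^sub>R e"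
  define b where "b = y - r *\<^sub>R e"
  have ab: "a - b = (2 * r - d) *\<^sub>R e"
  proof -
    have "a - b = (2 * r) *\<^sub>R e - (y - x)" by (simp add: a_def b_def algebra_simps flip: scaleR_2)
    then show ?thesis using e by (simp add: algebra_simps)
  qed
  have ay: "a - y = (r - d) *\<^sub>R e" and bx: "b - x = - ((r - d) *\<^sub>R e)"
    using e by (simp_all add: a_def b_def algebra_simps)
  have distax: "dist a x = r" "dist b y = r" using e r by (simp_all add: a_def b_def dist_norm)
  have "dist c a \<le> r" "dist c b \<le> r" if "c \<in> X" for c
  proof -
    have "dist y a = r - d" "dist x b = r - d" using ay bx e d by (simp_all add: dist_norm norm_minus_commute)
    moreover have "dist c y \<le> d" "dist c x \<le> d" using diam that xy by (auto simp: d_def)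
    ultimately show "dist c a \<le> r" "dist c b \<le> r"
      using dist_triangle[of c a y] dist_triangle[of c b x] by auto
  qed
  then have inD: "a \<in> D" "b \<in> D" by (auto simp: D)
  have cl: "closed D" by (auto simp: D)
  have slab: "e \<bullet> z \<le> e \<bullet> a" "e \<bullet> b \<le> e \<bullet> z" if "z \<in> D" for z
  proof -
    have ee: "e \<bullet> e = 1" using e by (simp add: dot_square_norm)
    have "norm (z - x) \<le> r" "norm (y - z) \<le> r"
      using that xy by (auto simp: D dist_norm norm_minus_commute)
    then have "e \<bullet> (z - x) \<le> r" "e \<bullet> (y - z) \<le> r"
      using norm_cauchy_schwarz[of e "z - x"] norm_cauchy_schwarz[of e "y - z"] e by auto
    then show "e \<bullet> z \<le> e \<bullet> a" "e \<bullet> b \<le> e \<bullet> z"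
      using ee by (auto simp: a_def b_def inner_simps)
  qed
  have fr: "p \<in> frontier D" if "p \<in> D" "c \<in> X" "dist p c = r" for p c
  proof -
    have "interior D \<subseteq> ball c r"
      using that by (metis D INF_lower interior_cball interior_mono)
    then have "p \<notin> interior D" using that by (auto simp: dist_commute)
    then show ?thesis using that cl by (simp add: frontier_def)
  qed
  have pos: "2 * r - d > 0" using d r by simp
  have "generalized_billiard_trajectory D [a, b]"
  proof (rule double_normal_trajectory)
    show "a \<in> frontier D" "b \<in> frontier D" using fr inD xy distax by auto
    have "norm (a - b) > 0" using ab pos e by simp
    then show "a \<noteq> b" by auto
    show "(a - b) \<bullet> b \<le> (a - b) \<bullet> z \<and> (a - b) \<bullet> z \<le> (a - b) \<bullet> a" if "z \<in> D" for z
      using slab[OF that] pos by (simp add: ab)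
  qed (rule cl)
  moreover have "dist a b = 2 * r - d" using ab e pos by (simp add: dist_norm)
  ultimately show ?thesis by (auto simp: path_len_two d_def intro!: exI[of _ "[a, b]"])
qed

section \<open>Normals at the vertices of a trajectory\<close>

lemma arccos_half:
  assumes "-1 \<le> c" "c \<le> 1"
  shows "arccos (sqrt ((1 + c) / 2)) = arccos c / 2"
proof -
  define h where "h = arccos c / 2"
  have h: "0 \<le> h" "h \<le> pi / 2" using assms arccos_bounded[of c] by (auto simp: h_def)
  have "c = 2 * (cos h)\<^sup>2 - 1" using assms cos_double_cos[of h] by (simp add: h_def)
  then have "sqrt ((1 + c) / 2) = cos h" using h by (simp add: cos_ge_zero)
  then show ?thesis using h by (simp add: arccos_cos h_def[symmetric])
qed

text \<open>The sum of the unit vectors along the two sides spans the bisector, by the half-angle formula for the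
  cosine.\<close>

lemma angle_bisector_direction:
  assumes ab: "a \<noteq> p" "b \<noteq> p" and ang: "angle_at a p b \<noteq> pi"
  defines "w \<equiv> sgn (a - p) + sgn (b - p)"
  shows "w \<noteq> 0" and "p + w \<in> inner_angle_bisector a p b"
proof -
  define e f where "e = sgn (a - p)" and "f = sgn (b - p)"
  have ef: "norm e = 1" "norm f = 1" using ab by (auto simp: e_def f_def norm_sgn)
  define c where "c = e \<bullet> f"
  have c: "-1 \<le> c" "c \<le> 1" using Cauchy_Schwarz_ineq2[of e f] ef by (auto simp: c_def)
  have angc: "angle_at a p b = arccos c"
    by (simp add: angle_at_def c_def e_def f_def sgn_div_norm divide_inverse mult_ac)
  have c1: "c \<noteq> -1" using ang angc by auto
  have ii: "e \<bullet> e = 1" "f \<bullet> f = 1" using ef by (auto simp: dot_square_norm)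
  have "w \<bullet> w = 2 + 2 * c"
    by (simp add: w_def c_def inner_add_left inner_add_right ii inner_commute flip: e_def f_def)
  then have nw: "norm w = sqrt (2 + 2 * c)" by (simp add: norm_eq_sqrt_inner)
  show "w \<noteq> 0" using nw c c1 by auto
  have "(1 + c) / sqrt (2 + 2 * c) = sqrt ((1 + c) / 2)"
  proof -
    have "(1 + c) / 2 * (2 + 2 * c) = (1 + c)\<^sup>2"
      by (simp add: power2_eq_square field_simps)
    then have "sqrt ((1 + c) / 2 * (2 + 2 * c)) = 1 + c"
      using c by (simp only: real_sqrt_abs abs_of_nonneg)
    then have "sqrt ((1 + c) / 2) * sqrt (2 + 2 * c) = 1 + c"
      by (simp only: real_sqrt_mult)
    then show ?thesis using c c1 by (simp add: field_simps)
  qed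
  moreover have "e \<bullet> w = 1 + c" "w \<bullet> f = 1 + c"
    by (simp_all add: w_def c_def inner_add_left inner_add_right ii inner_commute flip: e_def f_def)
  moreover have "angle_at a p (p + w) = arccos ((e \<bullet> w) / norm w)"
    by (simp add: angle_at_def e_def sgn_div_norm divide_inverse mult_ac)
  moreover have "angle_at (p + w) p b = arccos ((w \<bullet> f) / norm w)"
    by (simp add: angle_at_def f_def sgn_div_norm divide_inverse mult_ac)
  ultimately show "p + w \<in> inner_angle_bisector a p b"
    using \<open>w \<noteq> 0\<close> arccos_half[OF c] by (simp add: inner_angle_bisector_def angc nw)
qed

definition cross2 :: "real^2 \<Rightarrow> real^2 \<Rightarrow> real" where
  "cross2 u v = u $ 1 * v $ 2 - u $ 2 * v $ 1"

definition rot90 :: "real^2 \<Rightarrow> real^2" where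
  "rot90 u = vector [- u $ 2, u $ 1]"

lemma inner_2: "u \<bullet> v = u $ 1 * v $ 1 + u $ 2 * v $ 2" for u v :: "real^2"
  by (simp add: inner_vec_def sum_2)

text \<open>In the plane a vector perpendicular to the supporting line is a multiple of its normal; both neighbours
  lie in \<open>C\<close>, which determines the sign. The sum of the unit vectors along the sides is kept, since these
  sums cancel along a closed path.\<close>

lemma outer_normal_at_vertex:
  assumes ab: "a \<noteq> p" "b \<noteq> p" and ang: "angle_at a p b \<noteq> pi" and C: "a \<in> C" "b \<in> C"
    and L: "supporting_line C L" "p \<in> L" and perp: "perpendicular (inner_angle_bisector a p b) L"
  shows "\<exists>u l. norm u = 1 \<and> l > 0 \<and> sgn (a - p) + sgn (b - p) = - (l *\<^sub>R u) \<and>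
    (\<forall>x\<in>C. u \<bullet> x \<le> u \<bullet> p)"
proof -
  define w where "w = sgn (a - p) + sgn (b - p)"
  have w: "w \<noteq> 0" "p + w \<in> inner_angle_bisector a p b"
    using angle_bisector_direction[OF ab ang] by (auto simp: w_def)
  obtain n h where n: "n \<noteq> 0" "L = {x. n \<bullet> x = h}" "\<And>x. x \<in> C \<Longrightarrow> n \<bullet> x \<le> h"
    using L unfolding supporting_line_def by auto
  have h: "h = n \<bullet> p" using n L by auto
  have "n \<bullet> rot90 n = 0" by (simp add: inner_2 rot90_def)
  then have "p + rot90 n \<in> L" using n h by (simp add: inner_add_right)
  moreover have "p \<in> inner_angle_bisector a p b" by (simp add: inner_angle_bisector_def)
  ultimately have "orthogonal (p + w - p) (p + rot90 n - p)"
    using perp w L unfolding perpendicular_def by blast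
  then have o: "w $ 2 * n $ 1 = w $ 1 * n $ 2" by (simp add: orthogonal_def inner_2 rot90_def)
  have "(n \<bullet> n) * w $ 1 = (w \<bullet> n) * n $ 1" "(n \<bullet> n) * w $ 2 = (w \<bullet> n) * n $ 2"
    using o unfolding inner_2 by algebra+
  then have "(n \<bullet> n) *\<^sub>R w = (w \<bullet> n) *\<^sub>R n"
    by (simp add: vec_eq_iff forall_2)
  then have wn: "w = ((w \<bullet> n) / (n \<bullet> n)) *\<^sub>R n"
    using n(1) by (metis (no_types, lifting) divideR_right divide_inverse_commute inner_eq_zero_iff scaleR_scaleR)
  have "n \<bullet> w \<le> 0"
  proof -
    have "n \<bullet> (a - p) \<le> 0" "n \<bullet> (b - p) \<le> 0" using n(3) C h by (auto simp: inner_diff_right)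
    then have "n \<bullet> sgn (a - p) \<le> 0" "n \<bullet> sgn (b - p) \<le> 0"
      by (auto simp: sgn_div_norm divide_le_0_iff mult_le_0_iff)
    then show ?thesis by (simp add: w_def inner_add_right)
  qed
  moreover have "w \<bullet> n \<noteq> 0" using wn w by auto
  ultimately have neg: "w \<bullet> n < 0" by (simp add: inner_commute)
  define l where "l = - (w \<bullet> n) / norm n"
  have "w = - (l *\<^sub>R (sgn n))"
    using wn n(1) by (simp add: l_def sgn_div_norm dot_square_norm power2_eq_square divide_inverse mult_ac)
  moreover have "l > 0" using neg n(1) by (simp add: l_def divide_neg_pos)
  moreover have "norm (sgn n) = 1" using n(1) by (simp add: norm_sgn)
  moreover have "\<forall>x\<in>C. sgn n \<bullet> x \<le> sgn n \<bullet> p"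
    using n h by (auto simp: sgn_div_norm mult_left_mono)
  ultimately show ?thesis unfolding w_def by blast
qed

section \<open>Inscribed triangles\<close>

text \<open>Here \<open>S\<^sub>k\<close>, \<open>C\<^sub>k\<close> are the sines and cosines of the angles of an acute triangle. In terms of the
  semiperimeter, the circumradius \<open>R\<close> and the inradius \<open>\<rho>\<close> the sums are \<open>s / R\<close> and \<open>1 + \<rho> / R\<close>, and the
  strict inequality follows from the classical identity
  \<open>s\<^sup>2 - (2 R + \<rho>)\<^sup>2 = 4 R\<^sup>2 C\<^sub>1 C\<^sub>2 C\<^sub>3\<close>.\<close>

lemma acute_angle_sums:
  fixes S1 S2 C1 C2 :: real
  assumes sc: "S1\<^sup>2 + C1\<^sup>2 = 1" "S2\<^sup>2 + C2\<^sup>2 = 1"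
    and pos: "S1 > 0" "S2 > 0" "C1 > 0" "C2 > 0" "S1 * S2 - C1 * C2 > 0"
  defines "C3 \<equiv> S1 * S2 - C1 * C2" and "S3 \<equiv> S1 * C2 + C1 * S2"
  shows "1 \<le> C1 + C2 + C3" and "1 + (C1 + C2 + C3) < S1 + S2 + S3"
proof -
  have ge: "1 - C \<le> S" "C \<le> 1" if "S\<^sup>2 + C\<^sup>2 = 1" "S > 0" "C > 0" for S C :: real
  proof -
    have "C\<^sup>2 \<le> 1\<^sup>2" using that(1) zero_le_power2[of S] unfolding one_power2 by linarith
    then show "C \<le> 1" using power2_le_imp_le[of C 1] by simp
    have "(S + C)\<^sup>2 \<ge> 1\<^sup>2" using that by (simp add: power2_sum)
    then show "1 - C \<le> S" using power2_le_imp_le[of 1 "S + C"] that by simp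
  qed
  have "(1 - C1) * (1 - C2) \<le> S1 * S2"
    using ge[OF sc(1)] ge[OF sc(2)] pos by (intro mult_mono) auto
  then show "1 \<le> C1 + C2 + C3" by (simp add: C3_def algebra_simps)
  have "(S1 + S2 + S3)\<^sup>2 - (1 + (C1 + C2 + C3))\<^sup>2 = 4 * (C1 * C2 * C3)"
    using sc unfolding C3_def S3_def by algebra
  moreover have "C1 * C2 * C3 > 0" using pos by (simp add: C3_def)
  ultimately have "(1 + (C1 + C2 + C3))\<^sup>2 < (S1 + S2 + S3)\<^sup>2" by simp
  moreover have "S1 + S2 + S3 \<ge> 0" using pos by (simp add: S3_def)
  ultimately show "1 + (C1 + C2 + C3) < S1 + S2 + S3" by (rule power2_less_imp_less)
qed

lemma unit_inner_le_norm: "norm u = 1 \<Longrightarrow> u \<bullet> v \<le> norm v"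
  using norm_cauchy_schwarz[of u v] by simp

text \<open>The triangle with outer normals \<open>u\<^sub>k\<close> has angles with sines \<open>S\<^sub>k\<close> and cosines \<open>C\<^sub>k\<close>. The unit vectors
  \<open>d\<^sub>1\<close>, \<open>d\<^sub>2\<close>, \<open>d\<^sub>3\<close> are the side directions of its billiard triangle, that is, the triangle of altitude feet;
  reflection at the side with normal \<open>u\<^sub>1\<close> turns \<open>d\<^sub>3\<close> into \<open>d\<^sub>1\<close>, and so on. Multiplying out
  \<open>\<Sum> d\<^sub>i \<bullet> (p\<^sub>i\<^sub>+\<^sub>1 - p\<^sub>i)\<close> gives \<open>2 r (S\<^sub>1 + S\<^sub>2 + S\<^sub>3)\<close> plus the contribution
  \<open>\<Sum> d\<^sub>i \<bullet> (q\<^sub>i\<^sub>+\<^sub>1 - q\<^sub>i)\<close> of the centers. As the differences of the \<open>q\<^sub>i\<close> sum to \<open>0\<close>, one may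
  subtract a common vector from all the \<open>d\<^sub>i\<close> there. The choice \<open>d\<^sub>1 + d\<^sub>2 + d\<^sub>3\<close>, the orthocenter of the
  triangle \<open>d\<^sub>1 d\<^sub>2 d\<^sub>3\<close> inscribed in the unit circle, leaves vectors of norms \<open>2 C\<^sub>k\<close>, so the contribution
  is at least \<open>- 2 d (C\<^sub>1 + C\<^sub>2 + C\<^sub>3)\<close>; then \<open>acute_angle_sums\<close> applies.\<close>

lemma perimeter_if_acute:
  fixes u1 u2 u3 q1 q2 q3 :: "real^2"
  assumes unit: "norm u1 = 1" "norm u2 = 1" "norm u3 = 1"
    and acute: "u1 \<bullet> u2 < 0" "u2 \<bullet> u3 < 0" "u3 \<bullet> u1 < 0"
    and orient: "cross2 u1 u2 > 0" "cross2 u2 u3 > 0" "cross2 u3 u1 > 0"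
    and q: "dist q1 q2 \<le> d" "dist q2 q3 \<le> d" "dist q3 q1 \<le> d" and d: "d \<le> r" and r: "r > 0"
    and p: "p1 = q1 + r *\<^sub>R u1" "p2 = q2 + r *\<^sub>R u2" "p3 = q3 + r *\<^sub>R u3"
  shows "2 * (2 * r - d) < dist p1 p2 + dist p2 p3 + dist p3 p1"
proof -
  define C1 C2 C3 where "C1 = - (u2 \<bullet> u3)" and "C2 = - (u3 \<bullet> u1)" and "C3 = - (u1 \<bullet> u2)"
  define S1 S2 S3 where "S1 = cross2 u2 u3" and "S2 = cross2 u3 u1" and "S3 = cross2 u1 u2"
  note defs = C1_def C2_def C3_def S1_def S2_def S3_def
  have uu: "u1 \<bullet> u1 = 1" "u2 \<bullet> u2 = 1" "u3 \<bullet> u3 = 1" using unit by (auto simp: dot_square_norm)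
  have lagrange: "(cross2 u v)\<^sup>2 + (- (u \<bullet> v))\<^sup>2 = (u \<bullet> u) * (v \<bullet> v)" for u v
    unfolding cross2_def inner_2 by algebra
  have sc: "S1\<^sup>2 + C1\<^sup>2 = 1" "S2\<^sup>2 + C2\<^sup>2 = 1" "S3\<^sup>2 + C3\<^sup>2 = 1"
    unfolding defs lagrange using uu by auto
  have "S1 * S2 - C1 * C2 = (u3 \<bullet> u3) * C3" "S1 * C2 + C1 * S2 = (u3 \<bullet> u3) * S3"
    unfolding defs cross2_def inner_2 by algebra+
  then have add: "C3 = S1 * S2 - C1 * C2" "S3 = S1 * C2 + C1 * S2" using uu by auto
  have pos: "S1 > 0" "S2 > 0" "C1 > 0" "C2 > 0" "C3 > 0" using orient acute by (auto simp: defs)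
  have sums: "1 \<le> C1 + C2 + C3" "1 + (C1 + C2 + C3) < S1 + S2 + S3"
    using acute_angle_sums[OF sc(1,2)] pos unfolding add by auto
  define d1 where "d1 = C1 *\<^sub>R rot90 u1 - S1 *\<^sub>R u1"
  define d2 where "d2 = C2 *\<^sub>R rot90 u2 - S2 *\<^sub>R u2"
  define d3 where "d3 = C3 *\<^sub>R rot90 u3 - S3 *\<^sub>R u3"
  have d': "d1 = C2 *\<^sub>R rot90 u2 + S2 *\<^sub>R u2" "d2 = C3 *\<^sub>R rot90 u3 + S3 *\<^sub>R u3"
    "d3 = C1 *\<^sub>R rot90 u1 + S1 *\<^sub>R u1"
    by (simp_all add: d1_def d2_def d3_def defs vec_eq_iff forall_2 rot90_def cross2_def inner_2 algebra_simps)
  have rot: "rot90 u \<bullet> u = 0" "norm (rot90 u) = norm u" for u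
    by (simp_all add: rot90_def inner_2 norm_eq_sqrt_inner)
  have dbl: "(w + s *\<^sub>R u) - (w - s *\<^sub>R u) = (2 * s) *\<^sub>R u"
    and dbl': "(c *\<^sub>R v + s *\<^sub>R u) + (c *\<^sub>R v - s *\<^sub>R u) = (2 * c) *\<^sub>R v"
    for c s and u v w :: "real^2" by (simp_all add: vec_eq_iff)
  have unitd: "norm (c *\<^sub>R rot90 u - s *\<^sub>R u) = 1" if "s\<^sup>2 + c\<^sup>2 = 1" "norm u = 1" for c s u
  proof -
    have "rot90 u \<bullet> rot90 u = 1" "u \<bullet> u = 1" using that rot by (simp_all add: dot_square_norm)
    then have "(c *\<^sub>R rot90 u - s *\<^sub>R u) \<bullet> (c *\<^sub>R rot90 u - s *\<^sub>R u) = c\<^sup>2 + s\<^sup>2"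
      using rot(1)[of u] by (simp add: inner_diff_left inner_diff_right inner_commute power2_eq_square)
    then show ?thesis using that by (simp add: norm_eq_sqrt_inner)
  qed
  have "d1 \<bullet> (p2 - p1) \<le> dist p1 p2" "d2 \<bullet> (p3 - p2) \<le> dist p2 p3" "d3 \<bullet> (p1 - p3) \<le> dist p3 p1"
    unfolding d1_def d2_def d3_def dist_norm norm_minus_commute[of p1 p2]
      norm_minus_commute[of p2 p3] norm_minus_commute[of p3 p1]
    using sc unit by (auto intro!: unit_inner_le_norm unitd)
  moreover have "d1 \<bullet> (p2 - p1) + d2 \<bullet> (p3 - p2) + d3 \<bullet> (p1 - p3)
      = (d3 - d1) \<bullet> p1 + (d1 - d2) \<bullet> p2 + (d2 - d3) \<bullet> p3"
    by (simp add: inner_diff_left inner_diff_right)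
  moreover have diffs: "d3 - d1 = (2 * S1) *\<^sub>R u1" "d1 - d2 = (2 * S2) *\<^sub>R u2" "d2 - d3 = (2 * S3) *\<^sub>R u3"
    using dbl[of "C1 *\<^sub>R rot90 u1" S1 u1] dbl[of "C2 *\<^sub>R rot90 u2" S2 u2]
      dbl[of "C3 *\<^sub>R rot90 u3" S3 u3]
    by (simp_all only: d1_def[symmetric] d2_def[symmetric] d3_def[symmetric] d'[symmetric])
  ultimately have "2 * S1 * (u1 \<bullet> p1) + 2 * S2 * (u2 \<bullet> p2) + 2 * S3 * (u3 \<bullet> p3)
      \<le> dist p1 p2 + dist p2 p3 + dist p3 p1" by simp
  moreover have "u1 \<bullet> p1 = u1 \<bullet> q1 + r" "u2 \<bullet> p2 = u2 \<bullet> q2 + r" "u3 \<bullet> p3 = u3 \<bullet> q3 + r"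
    using p uu by (auto simp: inner_add_right)
  moreover have "2 * S1 * (u1 \<bullet> q1) + 2 * S2 * (u2 \<bullet> q2) + 2 * S3 * (u3 \<bullet> q3)
      \<ge> - (2 * C1 * d + 2 * C2 * d + 2 * C3 * d)"
  proof -
    have "2 * S1 * (u1 \<bullet> q1) + 2 * S2 * (u2 \<bullet> q2) + 2 * S3 * (u3 \<bullet> q3)
      = (d3 - d1) \<bullet> q1 + (d1 - d2) \<bullet> q2 + (d2 - d3) \<bullet> q3" using diffs by simp
    \<comment> \<open>This is the step that subtracts the orthocenter from the \<open>d\<^sub>i\<close>.\<close>
    also have "\<dots> = - ((d3 + d1) \<bullet> (q3 - q2) + (d1 + d2) \<bullet> (q1 - q3) + (d2 + d3) \<bullet> (q2 - q1))"
      by (simp add: inner_diff_left inner_diff_right inner_add_left)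
    also have "d3 + d1 = (2 * C1) *\<^sub>R rot90 u1" unfolding d'(3) d1_def by (rule dbl')
    also have "d1 + d2 = (2 * C2) *\<^sub>R rot90 u2" unfolding d'(1) d2_def by (rule dbl')
    also have "d2 + d3 = (2 * C3) *\<^sub>R rot90 u3" unfolding d'(2) d3_def by (rule dbl')
    finally have eq: "2 * S1 * (u1 \<bullet> q1) + 2 * S2 * (u2 \<bullet> q2) + 2 * S3 * (u3 \<bullet> q3)
      = - (2 * C1 * (rot90 u1 \<bullet> (q3 - q2)) + 2 * C2 * (rot90 u2 \<bullet> (q1 - q3))
          + 2 * C3 * (rot90 u3 \<bullet> (q2 - q1)))" by simp
    have "rot90 u1 \<bullet> (q3 - q2) \<le> d" "rot90 u2 \<bullet> (q1 - q3) \<le> d" "rot90 u3 \<bullet> (q2 - q1) \<le> d"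
      using unit_inner_le_norm[of "rot90 u1" "q3 - q2"] unit_inner_le_norm[of "rot90 u2" "q1 - q3"]
        unit_inner_le_norm[of "rot90 u3" "q2 - q1"] q unit rot
      by (auto simp: dist_norm norm_minus_commute)
    then have "2 * C1 * (rot90 u1 \<bullet> (q3 - q2)) \<le> 2 * C1 * d"
      "2 * C2 * (rot90 u2 \<bullet> (q1 - q3)) \<le> 2 * C2 * d"
      "2 * C3 * (rot90 u3 \<bullet> (q2 - q1)) \<le> 2 * C3 * d" using pos by auto
    then show ?thesis unfolding eq by linarith
  qed
  moreover have "2 * (2 * r - d) < 2 * r * (S1 + S2 + S3) - 2 * d * (C1 + C2 + C3)"
  proof -
    have "(r - d) * 1 \<le> (r - d) * (C1 + C2 + C3)" using sums d by (intro mult_left_mono) auto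
    moreover have "r * (1 + (C1 + C2 + C3)) < r * (S1 + S2 + S3)" using sums r by simp
    ultimately show ?thesis by (simp add: algebra_simps)
  qed
  ultimately show ?thesis by (simp add: algebra_simps)
qed

text \<open>The vectors of norm at most \<open>1\<close> for the sides \<open>p\<^sub>1 p\<^sub>2\<close>, \<open>p\<^sub>2 p\<^sub>3\<close>, \<open>p\<^sub>3 p\<^sub>1\<close> are \<open>e\<close>, \<open>u\<^sub>3\<close>, \<open>- u\<^sub>3\<close>;
  that the angle between \<open>u\<^sub>1\<close> and \<open>u\<^sub>2\<close> is not obtuse is exactly what makes the norm of \<open>e\<close> at most
  \<open>1\<close>. In the case of equality both sides at \<open>p\<^sub>3\<close> are parallel to \<open>u\<^sub>3\<close>, hence so is \<open>p\<^sub>2 - p\<^sub>1\<close>; but the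
  product of \<open>e\<close> and \<open>u\<^sub>3\<close> is less than \<open>1\<close> in absolute value, so \<open>p\<^sub>1\<close> and \<open>p\<^sub>2\<close> coincide.\<close>

lemma perimeter_if_not_acute:
  fixes u1 u2 u3 q1 q2 q3 :: "'a::real_inner"
  assumes unit: "norm u1 = 1" "norm u2 = 1" "norm u3 = 1"
    and m: "m1 > 0" "m2 > 0" "u3 = - (m1 *\<^sub>R u1 + m2 *\<^sub>R u2)" and wide: "u1 \<bullet> u2 \<ge> 0"
    and q: "dist q1 q2 \<le> d" "dist q2 q3 \<le> d" "dist q3 q1 \<le> d" and d: "d \<le> r"
    and p: "p1 = q1 + r *\<^sub>R u1" "p2 = q2 + r *\<^sub>R u2" "p3 = q3 + r *\<^sub>R u3"
  shows "2 * (2 * r - d) \<le> dist p1 p2 + dist p2 p3 + dist p3 p1"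
    and "p1 \<noteq> p2 \<Longrightarrow> 2 * (2 * r - d) < dist p1 p2 + dist p2 p3 + dist p3 p1"
proof -
  have uu: "u1 \<bullet> u1 = 1" "u2 \<bullet> u2 = 1" "u3 \<bullet> u3 = 1" using unit by (auto simp: dot_square_norm)
  define e where "e = m2 *\<^sub>R u2 - m1 *\<^sub>R u1"
  have mm: "m1\<^sup>2 + m2\<^sup>2 + 2 * m1 * m2 * (u1 \<bullet> u2) = 1"
    using uu(3) unfolding m(3)
    by (simp add: inner_add_left inner_add_right uu inner_commute power2_eq_square algebra_simps)
  have prod: "m1 * m2 * (u1 \<bullet> u2) \<ge> 0" using m wide by simp
  have "e \<bullet> e = m1\<^sup>2 + m2\<^sup>2 - 2 * m1 * m2 * (u1 \<bullet> u2)"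
    by (simp add: e_def inner_diff_left inner_diff_right uu inner_commute power2_eq_square algebra_simps)
  then have "e \<bullet> e \<le> 1" using mm prod by simp
  then have "norm e \<le> 1" by (simp add: norm_eq_sqrt_inner)
  then have ev: "e \<bullet> v \<le> norm v" for v
    using norm_cauchy_schwarz[of e v] mult_right_mono[of "norm e" 1 "norm v"] by simp
  have sides: "e \<bullet> (p2 - p1) \<le> dist p1 p2" "u3 \<bullet> (p3 - p2) \<le> dist p2 p3" "u3 \<bullet> (p3 - p1) \<le> dist p3 p1"
    using ev[of "p2 - p1"] unit_inner_le_norm[OF unit(3), of "p3 - p2"]
      unit_inner_le_norm[OF unit(3), of "p3 - p1"]
    by (auto simp: dist_norm norm_minus_commute)
  have m12: "1 \<le> m1 + m2"
    using norm_triangle_ineq[of "m1 *\<^sub>R u1" "m2 *\<^sub>R u2"] unit m by (metis (no_types) abs_of_pos mult.right_neutral norm_minus_cancel norm_scaleR)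
  have "e \<bullet> (p2 - p1) + u3 \<bullet> (p3 - p2) + u3 \<bullet> (p3 - p1)
      = 2 * (u3 \<bullet> p3 + m1 * (u1 \<bullet> p1) + m2 * (u2 \<bullet> p2))"
    unfolding e_def m(3) by (simp add: inner_simps algebra_simps)
  also have "\<dots> = 2 * (r * (1 + m1 + m2) + (u3 \<bullet> q3 + m1 * (u1 \<bullet> q1) + m2 * (u2 \<bullet> q2)))"
    unfolding p by (simp add: inner_add_right uu algebra_simps)
  also have "u3 \<bullet> q3 + m1 * (u1 \<bullet> q1) + m2 * (u2 \<bullet> q2)
      = - (m1 * (u1 \<bullet> (q3 - q1)) + m2 * (u2 \<bullet> (q3 - q2)))"
    unfolding m(3) by (simp add: inner_simps algebra_simps)
  finally have sum: "e \<bullet> (p2 - p1) + u3 \<bullet> (p3 - p2) + u3 \<bullet> (p3 - p1)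
      = 2 * (r * (1 + m1 + m2) - (m1 * (u1 \<bullet> (q3 - q1)) + m2 * (u2 \<bullet> (q3 - q2))))" by simp
  have "u1 \<bullet> (q3 - q1) \<le> d" "u2 \<bullet> (q3 - q2) \<le> d"
    using unit_inner_le_norm[OF unit(1), of "q3 - q1"] unit_inner_le_norm[OF unit(2), of "q3 - q2"] q
    by (auto simp: dist_norm norm_minus_commute)
  then have "m1 * (u1 \<bullet> (q3 - q1)) \<le> m1 * d" "m2 * (u2 \<bullet> (q3 - q2)) \<le> m2 * d" using m by auto
  moreover have "(r - d) * 1 \<le> (r - d) * (m1 + m2)" using m12 d by (intro mult_left_mono) auto
  ultimately have lower: "2 * (2 * r - d) \<le> e \<bullet> (p2 - p1) + u3 \<bullet> (p3 - p2) + u3 \<bullet> (p3 - p1)"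
    unfolding sum by (simp add: algebra_simps)
  then show "2 * (2 * r - d) \<le> dist p1 p2 + dist p2 p3 + dist p3 p1" using sides by linarith
  assume ne: "p1 \<noteq> p2"
  show "2 * (2 * r - d) < dist p1 p2 + dist p2 p3 + dist p3 p1"
  proof (rule ccontr)
    assume "\<not> ?thesis"
    then have eq: "e \<bullet> (p2 - p1) = dist p1 p2" "u3 \<bullet> (p3 - p2) = dist p2 p3" "u3 \<bullet> (p3 - p1) = dist p3 p1"
      using lower sides by linarith+
    have "p3 - p2 = dist p2 p3 *\<^sub>R u3" "p3 - p1 = dist p3 p1 *\<^sub>R u3"
      using norm_cauchy_schwarz_eq[of u3 "p3 - p2"] norm_cauchy_schwarz_eq[of u3 "p3 - p1"] eq unit(3)
      by (simp_all add: dist_norm norm_minus_commute)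
    moreover define s where "s = dist p3 p1 - dist p2 p3"
    ultimately have s: "p2 - p1 = s *\<^sub>R u3" by (metis add_diff_cancel_left diff_diff_eq2 diff_add_cancel scaleR_left_diff_distrib)
    have "e \<bullet> u3 = m1\<^sup>2 - m2\<^sup>2"
      unfolding e_def m(3) by (simp add: inner_simps uu inner_commute power2_eq_square algebra_simps)
    moreover have "\<bar>m1\<^sup>2 - m2\<^sup>2\<bar> < 1" 
    proof -
      have "0 < m1\<^sup>2" "0 < m2\<^sup>2" "0 \<le> 2 * m1 * m2 * (u1 \<bullet> u2)" using m(1,2) prod by auto
      then show ?thesis using mm unfolding abs_less_iff by linarith
    qed
    ultimately have "\<bar>e \<bullet> u3\<bar> < 1" by simp
    moreover have s0: "s \<noteq> 0" using s ne by auto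
    ultimately have "\<bar>s\<bar> * \<bar>e \<bullet> u3\<bar> < \<bar>s\<bar>" by simp
    moreover have "s * (e \<bullet> u3) = \<bar>s\<bar>"
      using eq(1) unit(3) by (simp add: dist_norm norm_minus_commute[of p1] s)
    ultimately show False by (metis abs_mult abs_idempotent less_irrefl)
  qed
qed

text \<open>Either two of the normals form an angle of at most \<open>pi / 2\<close>, or all three angles are obtuse. In the
  latter case the three cross products have the same sign, and exchanging two normals makes them
  positive. They cannot vanish, as three pairwise antiparallel vectors do not exist.\<close>

lemma perimeter_if_normals_balanced:
  fixes u1 u2 u3 q1 q2 q3 :: "real^2"
  assumes unit: "norm u1 = 1" "norm u2 = 1" "norm u3 = 1"
    and m: "m1 > 0" "m2 > 0" "m3 > 0" "m1 *\<^sub>R u1 + m2 *\<^sub>R u2 + m3 *\<^sub>R u3 = 0"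
    and q: "dist q1 q2 \<le> d" "dist q2 q3 \<le> d" "dist q3 q1 \<le> d" and d: "d \<le> r" and r: "r > 0"
    and p: "p1 = q1 + r *\<^sub>R u1" "p2 = q2 + r *\<^sub>R u2" "p3 = q3 + r *\<^sub>R u3"
  shows "2 * (2 * r - d) < dist p1 p2 + dist p2 p3 + dist p3 p1 \<or>
    (2 * (2 * r - d) \<le> dist p1 p2 + dist p2 p3 + dist p3 p1 \<and> (p1 = p2 \<or> p2 = p3 \<or> p3 = p1))"
proof -
  have solve: "w = - ((a / c) *\<^sub>R u + (b / c) *\<^sub>R v)"
    if "a *\<^sub>R u + b *\<^sub>R v + c *\<^sub>R w = 0" "c > 0" for a b c :: real and u v w :: "real^2"
  proof -
    have "c *\<^sub>R w = - (a *\<^sub>R u + b *\<^sub>R v)" using that(1) by (metis add.commute eq_neg_iff_add_eq_0)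
    then have "(1 / c) *\<^sub>R (c *\<^sub>R w) = (1 / c) *\<^sub>R (- (a *\<^sub>R u + b *\<^sub>R v))" by simp
    then show ?thesis using that(2) by (simp add: scaleR_diff_right)
  qed
  consider "u1 \<bullet> u2 \<ge> 0" | "u2 \<bullet> u3 \<ge> 0" | "u3 \<bullet> u1 \<ge> 0"
    | "u1 \<bullet> u2 < 0" "u2 \<bullet> u3 < 0" "u3 \<bullet> u1 < 0" by linarith
  then show ?thesis
  proof cases
    case 1
    have eq: "u3 = - ((m1 / m3) *\<^sub>R u1 + (m2 / m3) *\<^sub>R u2)"
      using m by (intro solve) (auto simp: algebra_simps)
    have pos: "m1 / m3 > 0" "m2 / m3 > 0" using m by auto
    show ?thesis
      using perimeter_if_not_acute[OF unit(1) unit(2) unit(3) pos eq 1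
          q(1) q(2) q(3) d p(1) p(2) p(3)]
      by (smt (verit))
  next
    case 2
    have eq: "u1 = - ((m2 / m1) *\<^sub>R u2 + (m3 / m1) *\<^sub>R u3)"
      using m by (intro solve) (auto simp: algebra_simps)
    have pos: "m2 / m1 > 0" "m3 / m1 > 0" using m by auto
    show ?thesis
      using perimeter_if_not_acute[OF unit(2) unit(3) unit(1) pos eq 2
          q(2) q(3) q(1) d p(2) p(3) p(1)]
      by (smt (verit))
  next
    case 3
    have eq: "u2 = - ((m3 / m2) *\<^sub>R u3 + (m1 / m2) *\<^sub>R u1)"
      using m by (intro solve) (auto simp: algebra_simps)
    have pos: "m3 / m2 > 0" "m1 / m2 > 0" using m by auto
    show ?thesis
      using perimeter_if_not_acute[OF unit(3) unit(1) unit(2) pos eq 3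
          q(3) q(1) q(2) d p(3) p(1) p(2)]
      by (smt (verit))
  next
    case 4
    have comp: "m1 * u1 $ 1 + m2 * u2 $ 1 + m3 * u3 $ 1 = 0" "m1 * u1 $ 2 + m2 * u2 $ 2 + m3 * u3 $ 2 = 0"
      using arg_cong[OF m(4), of "\<lambda>v. v $ 1"] arg_cong[OF m(4), of "\<lambda>v. v $ 2"] by auto
    have cr: "m2 * cross2 u1 u2 = m3 * cross2 u3 u1" "m3 * cross2 u2 u3 = m1 * cross2 u1 u2"
      using comp unfolding cross2_def by algebra+
    have anti: "cross2 v u = - cross2 u v" for u v by (simp add: cross2_def)
    consider "cross2 u1 u2 > 0" | "cross2 u1 u2 < 0" | "cross2 u1 u2 = 0" by linarith
    then show ?thesis
    proof cases
      case 1
      then have "cross2 u3 u1 > 0" "cross2 u2 u3 > 0" using cr m by (metis zero_less_mult_pos mult_pos_pos)+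
      then show ?thesis
        using perimeter_if_acute[of u1 u2 u3 q1 q2 d q3 r p1 p2 p3] 1 4 unit q d r p by auto
    next
      case 2
      then have "cross2 u2 u1 > 0" "cross2 u1 u3 > 0" "cross2 u3 u2 > 0"
        using cr m anti by (smt (verit, best) mult_less_0_iff mult_pos_pos)+
      then show ?thesis
        using perimeter_if_acute[of u2 u1 u3 q2 q1 d q3 r p2 p1 p3] 4 unit q d r p
        by (auto simp: dist_commute inner_commute)
    next
      case 3
      then have "cross2 u3 u1 = 0" "cross2 u2 u3 = 0" using cr m by auto
      moreover have "(u1 \<bullet> u2) * (u3 \<bullet> u3) = (u2 \<bullet> u3) * (u3 \<bullet> u1) - cross2 u2 u3 * cross2 u3 u1"
        unfolding cross2_def inner_2 by algebra
      moreover have "u3 \<bullet> u3 = 1" using unit by (simp add: dot_square_norm)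
      ultimately have "u1 \<bullet> u2 = (u2 \<bullet> u3) * (u3 \<bullet> u1)" by simp
      moreover have "(u2 \<bullet> u3) * (u3 \<bullet> u1) > 0" using 4 by (simp add: mult_neg_neg)
      ultimately show ?thesis using 4 by simp
    qed
  qed
qed

lemma dist_if_normals_opposite:
  fixes u q q' :: "'a::real_inner"
  assumes "norm u = 1" "dist q q' \<le> d"
  shows "2 * r - d \<le> dist (q + r *\<^sub>R u) (q' - r *\<^sub>R u)"
proof -
  have "u \<bullet> u = 1" using assms by (simp add: dot_square_norm)
  then have "u \<bullet> ((q + r *\<^sub>R u) - (q' - r *\<^sub>R u)) = 2 * r - u \<bullet> (q' - q)"
    by (simp add: inner_simps)
  moreover have "u \<bullet> (q' - q) \<le> d"
    using unit_inner_le_norm[OF assms(1), of "q' - q"] assms(2) by (simp add: dist_norm norm_minus_commute)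
  ultimately show ?thesis
    using unit_inner_le_norm[OF assms(1), of "(q + r *\<^sub>R u) - (q' - r *\<^sub>R u)"] by (simp add: dist_norm)
qed

section \<open>Shortest trajectories\<close>

text \<open>Caratheodory's theorem in dimension two; a combination with a vanishing weight reduces to two vectors, which
  are then opposite because both have norm \<open>1\<close>.\<close>

lemma zero_in_convex_hull_of_unit_vectors:
  fixes U :: "(real^2) set"
  assumes U: "\<And>u. u \<in> U \<Longrightarrow> norm u = 1" and 0: "0 \<in> convex hull U"
  obtains (opposite) u where "u \<in> U" "- u \<in> U"
  | (triple) u1 u2 u3 m1 m2 m3 where "{u1, u2, u3} \<subseteq> U" "m1 > 0" "m2 > 0" "m3 > 0"
      "m1 *\<^sub>R u1 + m2 *\<^sub>R u2 + m3 *\<^sub>R u3 = 0"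
proof -
  have opp: "v = - u" if "a *\<^sub>R u + b *\<^sub>R v = 0" "a \<ge> 0" "b \<ge> 0" "a + b = 1" "u \<in> U" "v \<in> U" for u v a b
  proof -
    have "a *\<^sub>R u = - (b *\<^sub>R v)" using that(1) by (simp add: eq_neg_iff_add_eq_0)
    moreover from this have "norm (a *\<^sub>R u) = norm (b *\<^sub>R v)" by simp
    then have "a = b" using U that by simp
    ultimately have "b *\<^sub>R u = b *\<^sub>R (- v)" "b \<noteq> 0" using that(4) by auto
    then have "u = - v" by (simp only: scaleR_cancel_left) simp
    then show ?thesis by simp
  qed
  obtain T w where T: "finite T" "T \<subseteq> U" "card T \<le> 3" "\<forall>x\<in>T. 0 \<le> w x" "sum w T = 1" "(\<Sum>v\<in>T. w v *\<^sub>R v) = 0"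
    using 0 unfolding convex_hull_caratheodory by auto
  consider "card T = 0" | "card T = 1" | "card T = 2" | "card T = 3" using T(3) by linarith
  then show ?thesis
  proof cases
    case 1
    then show ?thesis using T by simp
  next
    case 2
    then obtain u where "T = {u}" by (auto simp: card_1_singleton_iff)
    then show ?thesis using T U[of u] by auto
  next
    case 3
    then obtain u v where "T = {u, v}" "u \<noteq> v" by (auto simp: card_2_iff)
    then show ?thesis using T opp[of "w u" u "w v" v] opposite[of u] by auto
  next
    case 4
    then obtain a b c where abc: "T = {a, b, c}" "a \<noteq> b" "b \<noteq> c" "a \<noteq> c" by (auto simp: card_3_iff)
    have s: "w a *\<^sub>R a + w b *\<^sub>R b + w c *\<^sub>R c = 0" "w a + w b + w c = 1"
      "w a \<ge> 0" "w b \<ge> 0" "w c \<ge> 0" "a \<in> U" "b \<in> U" "c \<in> U"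
      using T abc by (auto simp: add.assoc)
    consider "w a = 0" | "w b = 0" | "w c = 0" | "w a > 0" "w b > 0" "w c > 0" using s by linarith
    then show ?thesis
    proof cases
      case 1
      then show ?thesis using s opp[of "w b" b "w c" c] opposite[of b] by auto
    next
      case 2
      then show ?thesis using s opp[of "w a" a "w c" c] opposite[of a] by auto
    next
      case 3
      then show ?thesis using s opp[of "w a" a "w b" b] opposite[of a] by auto
    next
      case 4
      then show ?thesis using s triple[of a b c "w a" "w b" "w c"] by auto
    qed
  qed
qed

text \<open>The unit vectors along the sides cancel in the sum over all vertices, since every side occurs there
  once in each direction. Each vertex contributes a negative multiple of its outer normal, so the outer
  normals have a positive combination equal to \<open>0\<close>.\<close>

lemma trajectory_normals:
  assumes traj: "generalized_billiard_trajectory C P" and cl: "closed C"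
  obtains u :: "nat \<Rightarrow> real^2" where
    "\<And>i. i < length P \<Longrightarrow> norm (u i) = 1"
    "\<And>i x. i < length P \<Longrightarrow> x \<in> C \<Longrightarrow> u i \<bullet> x \<le> u i \<bullet> P ! i"
    "0 \<in> convex hull (u ` {..<length P})"
proof -
  let ?n = "length P"
  have P: "closed_polygonal_path P" "set P \<subseteq> C"
    using traj cl frontier_subset_closed[of C] by (auto simp: generalized_billiard_trajectory_def)
  have n: "?n \<ge> 2" using P by (simp add: closed_polygonal_path_def)
  define prv where "prv i = (i + ?n - 1) mod ?n" for i
  have prv: "prv i < ?n" "(prv i + 1) mod ?n = i" if "i < ?n" for i
  proof -
    show "prv i < ?n" unfolding prv_def using n by (intro mod_less_divisor) linarith
    have "(prv i + 1) mod ?n = (i + ?n - 1 + 1) mod ?n" unfolding prv_def by (rule mod_add_left_eq)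
    also have "i + ?n - 1 + 1 = i + ?n" using n by simp
    finally show "(prv i + 1) mod ?n = i" using that by (simp only: mod_add_self2 mod_less)
  qed
  have pv: "prev_vertex P i = P ! prv i" for i by (simp add: prev_vertex_def prv_def)
  have "\<exists>u l. norm u = 1 \<and> l > 0 \<and>
      sgn (prev_vertex P i - P ! i) + sgn (next_vertex P i - P ! i) = - (l *\<^sub>R u) \<and>
      (\<forall>x\<in>C. u \<bullet> x \<le> u \<bullet> P ! i)" if i: "i < ?n" for i
  proof -
    obtain L where L: "supporting_line C L" "P ! i \<in> L"
      "perpendicular (inner_angle_bisector (prev_vertex P i) (P ! i) (next_vertex P i)) L"
      using traj i by (auto simp: generalized_billiard_trajectory_def)
    have "prev_vertex P i \<noteq> P ! i"
      using P(1) prv[OF i] by (auto simp: closed_polygonal_path_def pv next_vertex_def)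
    moreover have "next_vertex P i \<noteq> P ! i" "angle_at (prev_vertex P i) (P ! i) (next_vertex P i) \<noteq> pi"
      using P(1) i by (auto simp: closed_polygonal_path_def)
    moreover have "next_vertex P i \<in> C" "prev_vertex P i \<in> C"
      using P(2) prv(1)[OF i] n by (auto simp: pv next_vertex_def intro!: subsetD[OF P(2)] nth_mem mod_less_divisor)
    ultimately show ?thesis using outer_normal_at_vertex L by blast
  qed
  then obtain u l where ul: "\<And>i. i < ?n \<Longrightarrow> norm (u i) = 1" "\<And>i. i < ?n \<Longrightarrow> l i > (0::real)"
      "\<And>i. i < ?n \<Longrightarrow> sgn (prev_vertex P i - P ! i) + sgn (next_vertex P i - P ! i) = - (l i *\<^sub>R u i)"
      "\<And>i x. i < ?n \<Longrightarrow> x \<in> C \<Longrightarrow> u i \<bullet> x \<le> u i \<bullet> P ! i"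
    by metis
  have bij: "bij_betw prv {..<?n} {..<?n}"
  proof (rule bij_betw_byWitness[where f' = "\<lambda>i. (i + 1) mod ?n"])
    show "\<forall>i\<in>{..<?n}. prv ((i + 1) mod ?n) = i"
    proof
      fix i assume i: "i \<in> {..<?n}"
      have "prv ((i + 1) mod ?n) = ((i + 1) mod ?n + (?n - 1)) mod ?n" using n by (simp add: prv_def)
      also have "\<dots> = ((i + 1) + (?n - 1)) mod ?n" by (rule mod_add_left_eq)
      also have "(i + 1) + (?n - 1) = i + ?n" using n by simp
      finally show "prv ((i + 1) mod ?n) = i" using i by simp
    qed
  qed (use prv n in \<open>auto intro!: mod_less_divisor\<close>)
  have "(\<Sum>i<?n. sgn (next_vertex P i - P ! i)) = (\<Sum>i<?n. sgn (next_vertex P (prv i) - P ! prv i))"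
    using sum.reindex_bij_betw[OF bij, of "\<lambda>i. sgn (next_vertex P i - P ! i)"] by simp
  also have "\<dots> = (\<Sum>i<?n. - sgn (prev_vertex P i - P ! i))"
  proof (intro sum.cong refl)
    fix i assume "i \<in> {..<?n}"
    then have "next_vertex P (prv i) = P ! i" using prv by (simp add: next_vertex_def)
    then show "sgn (next_vertex P (prv i) - P ! prv i) = - sgn (prev_vertex P i - P ! i)"
      by (metis minus_diff_eq pv sgn_minus)
  qed
  finally have "(\<Sum>i<?n. sgn (prev_vertex P i - P ! i) + sgn (next_vertex P i - P ! i)) = 0"
    by (simp add: sum.distrib sum_negf)
  moreover have "(\<Sum>i<?n. sgn (prev_vertex P i - P ! i) + sgn (next_vertex P i - P ! i))
      = (\<Sum>i<?n. - (l i *\<^sub>R u i))"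
    using ul(3) by (intro sum.cong) auto
  ultimately have bal: "(\<Sum>i<?n. l i *\<^sub>R u i) = 0" by (simp add: sum_negf)
  define s where "s = (\<Sum>i<?n. l i)"
  have s: "s > 0" unfolding s_def using ul(2) n by (intro sum_pos) (auto simp: lessThan_empty_iff)
  have "(\<Sum>i<?n. (l i / s) *\<^sub>R u i) \<in> convex hull (u ` {..<?n})"
  proof (intro convex_sum)
    show "(\<Sum>i<?n. l i / s) = 1" using s by (simp add: s_def flip: sum_divide_distrib)
    show "0 \<le> l i / s" if "i \<in> {..<?n}" for i using that ul(2)[of i] s by simp
    show "u i \<in> convex hull (u ` {..<?n})" if "i \<in> {..<?n}" for i using that by (intro hull_inc) auto
  qed auto
  moreover have "(\<Sum>i<?n. (l i / s) *\<^sub>R u i) = (1 / s) *\<^sub>R (\<Sum>i<?n. l i *\<^sub>R u i)"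
    by (simp add: scaleR_sum_right)
  ultimately have "0 \<in> convex hull (u ` {..<?n})" using bal by simp
  then show ?thesis using that[of u] ul by blast
qed

lemma trajectory_len_gt:
  fixes X :: "(real^2) set"
  assumes X: "finite X" and D: "D = (\<Inter>c\<in>X. cball c r)" and r: "r > 0"
    and diam: "\<And>c c'. c \<in> X \<Longrightarrow> c' \<in> X \<Longrightarrow> dist c c' \<le> d" and d: "d \<le> r"
    and traj: "generalized_billiard_trajectory D P" and n: "length P \<noteq> 2"
  shows "2 * (2 * r - d) < path_len P"
proof -
  let ?n = "length P"
  have cl: "closed D" by (auto simp: D)
  have P: "closed_polygonal_path P" "set P \<subseteq> D"
    using traj cl frontier_subset_closed[of D] by (auto simp: generalized_billiard_trajectory_def)
  obtain u where u: "\<And>i. i < ?n \<Longrightarrow> norm (u i) = 1"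
    "\<And>i x. i < ?n \<Longrightarrow> x \<in> D \<Longrightarrow> u i \<bullet> x \<le> u i \<bullet> P ! i"
    "0 \<in> convex hull (u ` {..<?n})"
    using trajectory_normals[OF traj cl] by metis
  define q where "q i = P ! i - r *\<^sub>R u i" for i
  have Pq: "P ! i = q i + r *\<^sub>R u i" for i by (simp add: q_def)
  have supp: "D \<subseteq> cball (q i) r" if i: "i < ?n" for i
  proof -
    have "P ! i \<in> D" using P(2) i by auto
    then show ?thesis
      using cball_supports_disk_intersection[OF X r, of "P ! i" "u i"] u(1,2)[OF i]
      by (simp only: D[symmetric] q_def)
  qed
  have qd: "dist (q i) (q j) \<le> d" if ij: "i < ?n" "j < ?n" for i j
  proof (rule dist_supporting_centers_le)
    show "dist c c' \<le> d" if "c \<in> X" "c' \<in> X" for c c' using that by (rule diam)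
    show "(\<Inter>c\<in>X. cball c r) \<subseteq> cball (q i) r" "(\<Inter>c\<in>X. cball c r) \<subseteq> cball (q j) r"
      using supp[OF ij(1)] supp[OF ij(2)] by (simp_all only: D)
  qed (rule d)
  note strict = two_dist_less_path_len[OF P(1) n]
  have unit: "norm v = 1" if "v \<in> u ` {..<?n}" for v using that u(1) by auto
  show ?thesis
  proof (rule zero_in_convex_hull_of_unit_vectors[OF unit u(3)])
    fix v assume v: "v \<in> u ` {..<?n}" "- v \<in> u ` {..<?n}"
    obtain i where i: "i < ?n" "v = u i" using v(1) by blast
    obtain j where j: "j < ?n" "- v = u j" using v(2) by blast
    have "u i \<bullet> u i = 1" using u(1)[OF i(1)] by (simp add: dot_square_norm)
    moreover have "u i \<bullet> u j = - (u i \<bullet> u i)" unfolding j(2)[symmetric] i(2) by simp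
    ultimately have "i \<noteq> j" by auto
    have "2 * r - d \<le> dist (P ! i) (P ! j)"
      using dist_if_normals_opposite[OF u(1)[OF i(1)] qd[OF i(1) j(1)], of r]
      unfolding Pq j(2)[symmetric] i(2) by simp
    then show ?thesis using strict[OF i(1) j(1) \<open>i \<noteq> j\<close>] by simp
  next
    fix v1 v2 v3 m1 m2 m3
    assume triple: "{v1, v2, v3} \<subseteq> u ` {..<?n}" "m1 > 0" "m2 > 0" "m3 > 0"
      "m1 *\<^sub>R v1 + m2 *\<^sub>R v2 + m3 *\<^sub>R v3 = 0"
    then obtain i j k where ijk: "i < ?n" "j < ?n" "k < ?n" "v1 = u i" "v2 = u j" "v3 = u k" by auto
    let ?per = "dist (P ! i) (P ! j) + dist (P ! j) (P ! k) + dist (P ! k) (P ! i)"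
    have bound: "2 * (2 * r - d) < ?per \<or>
      (2 * (2 * r - d) \<le> ?per \<and> (P ! i = P ! j \<or> P ! j = P ! k \<or> P ! k = P ! i))"
      using triple ijk u(1) qd d r Pq
      by (intro perimeter_if_normals_balanced[of "u i" "u j" "u k" m1 m2 m3 "q i" "q j" d "q k" r])
        (simp_all only:)
    have per_strict: "2 * dist (P ! a) (P ! b) < path_len P" if "a < ?n" "b < ?n" for a b
    proof (cases "a = b")
      case True
      have "2 \<le> ?n" using P(1) by (simp add: closed_polygonal_path_def)
      then have "2 * dist (P ! 0) (P ! 1) < path_len P" by (intro strict) auto
      then have "0 < path_len P" using zero_le_dist[of "P ! 0" "P ! 1"] by linarith
      then show ?thesis using True by simp
    qed (use that strict in auto)
    show ?thesis
      using bound triangle_perimeter_le_path_len[OF ijk(1-3)] per_strict[of i j] per_strict[of j k]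
        per_strict[of k i] ijk(1-3)
      by (auto simp: dist_commute)
  qed
qed

theorem theorem1p2:
  fixes D :: "(real^2) set" and r :: real and P :: "(real^2) list"
  assumes "fat_disk_polygon r D"
    and "shortest_generalized_billiard_trajectory D P"
  shows "n_periodic 2 P"
proof (rule ccontr)
  assume "\<not> n_periodic 2 P"
  then have n: "length P \<noteq> 2" by (simp add: n_periodic_def)
  obtain X where r: "r > 0" and X: "finite X" "X \<noteq> {}" and D: "D = (\<Inter>c\<in>X. cball c r)"
    and fat: "\<And>c c'. c \<in> X \<Longrightarrow> c' \<in> X \<Longrightarrow> dist c c' \<le> r"
    using assms(1) by (auto simp: fat_disk_polygon_def generating_centers_def)
  let ?dists = "(\<lambda>(c, c'). dist c c') ` (X \<times> X)"
  have dists: "finite ?dists" "?dists \<noteq> {}" using X by auto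
  obtain x y where xy: "x \<in> X" "y \<in> X" and max: "dist x y = Max ?dists"
    using Max_in[OF dists] by auto
  have diam: "dist c c' \<le> dist x y" if "c \<in> X" "c' \<in> X" for c c'
    unfolding max using dists(1) that by (intro Max_ge) auto
  obtain Q where "generalized_billiard_trajectory D Q" "path_len Q = 2 * (2 * r - dist x y)"
    using two_periodic_trajectory_of_diameter[OF D r xy diam fat[OF xy]] by blast
  moreover have "2 * (2 * r - dist x y) < path_len P"
    using assms(2) n by (intro trajectory_len_gt[OF X(1) D r diam fat[OF xy]])
      (auto simp: shortest_generalized_billiard_trajectory_def)
  ultimately show False
    using assms(2) by (auto simp: shortest_generalized_billiard_trajectory_def)
qed

end
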